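(* Let $A=(a_{ij})\in\mathbb{R}^{m\times s}$ be a constant matrix and let $\beta=(b_1(x_1,x_2,x_3,t),\dots,b_m(x_1,x_2,x_3,t))^T$ be a given $m$-dimensional vector of real-valued functions on $\mathbb{R}^4$. Consider the equation $AX=\beta$, where the unknown $X=(X_1(x_1,x_2,x_3,t),\dots,X_s(x_1,x_2,x_3,t))^T$ is an $s$-dimensional vector of real-valued functions on $\mathbb{R}^4$. Then: (1) The equation $AX=\beta$ has a solution if and only if for every $(x_1,x_2,x_3,t)^T\in\mathbb{R}^4$, $$\operatorname{rank}(A,\ \beta(x_1,x_2,x_3,t))=\operatorname{rank}(A),$$ where $\beta(x_1,x_2,x_3,t)\in\mathbb{R}^m$ is the value of $\beta$ at the given point and $(A,\beta(x_1,x_2,x_3,t))$ is the augmented matrix. (2) Suppose the equation $AX=\beta$ has a solution, $\operatorname{rank}(A)=r$ with $r<s$, $X_0$ is a particular solution of $AX=\beta$, and $\eta_1,\dots,\eta_{s-r}\in\mathbb{R}^s$ are linearly independent constant solutions of $AX=0$. Put $A(\eta)=[\eta_1,\eta_2,\dots,\eta_{s-r}]$ (the $s\times(s-r)$ matrix with these columns). Then the general solution of $AX=\beta$ is $$X=X_0+A(\eta)Z_1,$$ where $Z_1$ is an arbitrary $(s-r)$-dimensional vector of real-valued functions on $\mathbb{R}^4$; that is, every such $X$ is a solution and every solution has this form.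
   Context: No regularity is required of the functions: the equation $AX=\beta$ means equality at every point of $\mathbb{R}^4$. *)

theory Defs
  imports "HOL-Analysis.Analysis"
begin

text \<open>A vector of real-valued functions on \<open>\<real>\<^sup>4\<close> is represented as a vector-valued function of
  the point \<open>p = (x\<^sub>1, x\<^sub>2, x\<^sub>3, t)\<close>.\<close>

definition is_solution ::
  "real^'s^'m \<Rightarrow> (real^4 \<Rightarrow> real^'m) \<Rightarrow> (real^4 \<Rightarrow> real^'s) \<Rightarrow> bool"
  where "is_solution A \<beta> X \<longleftrightarrow> (\<forall>p. A *v X p = \<beta> p)"

text \<open>The augmented matrix \<open>(A, b)\<close>: its columns are indexed by the columns of \<open>A\<close> together with
  one further index.\<close>

definition augmented :: "real^'s^'m \<Rightarrow> real^'m \<Rightarrow> real^('s + 1)^'m"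
  where "augmented A b = (\<chi> i j. case j of Inl k \<Rightarrow> A $ i $ k | Inr _ \<Rightarrow> b $ i)"

definition matrix_of_columns :: "('k \<Rightarrow> real^'s) \<Rightarrow> real^'k^'s"
  where "matrix_of_columns \<eta> = (\<chi> i j. \<eta> j $ i)"

text \<open>Linear independence of a family; \<open>independent (range \<eta>)\<close> alone would ignore repetitions.\<close>

definition independent_family :: "('k \<Rightarrow> real^'s) \<Rightarrow> bool"
  where "independent_family \<eta> \<longleftrightarrow> inj \<eta> \<and> independent (range \<eta>)"

end

theory Submission imports Defs begin

text \<open>Since no regularity is required, the equation is a family of independent linear systems,
  one at each point, and a choice function glues pointwise solutions together. A single system is
  solvable iff its right-hand side lies in the column space, that is, iff adjoining it as a column
  keeps the rank (\<open>rank_augmented_eq_iff\<close>). For the general solution, the null space of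
  \<open>A\<close> has dimension \<open>s - r\<close> (\<open>dim_nullspace\<close>), so the
  \<open>s - r\<close> independent vectors in it form a basis (\<open>nullspace_eq_span\<close>).
  Two solutions differ at each point by a combination of this basis, and the coefficients are chosen
  pointwise (\<open>solutions_eq\<close>).\<close>

lemma range_matrix_vector_mult_eq_span_columns:
  fixes A :: "real^'n^'m"
  shows "range ((*v) A) = span (columns A)"
proof (rule subset_antisym)
  show "range ((*v) A) \<subseteq> span (columns A)"
    using matrix_vector_mult_in_columnspace by blast
  show "span (columns A) \<subseteq> range ((*v) A)"
    \<comment> \<open>Each column is the image of a standard basis vector, and the range is a
      subspace.\<close>
    by (intro span_minimal linear_subspace_image) (auto simp: columns_image_basis)
qed

lemma columns_augmented: "columns (augmented A b) = insert b (columns A)"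
proof -
  have "column (Inl k) (augmented A b) = column k A" "column (Inr u) (augmented A b) = b" for k u
    by (simp_all add: column_def augmented_def vec_eq_iff)
  then have "(\<lambda>j. column j (augmented A b)) ` UNIV = insert b (range (\<lambda>k. column k A))"
    by (simp add: UNIV_sum image_Un image_image)
  then show ?thesis
    by (simp add: columns_def full_SetCompr_eq)
qed

text \<open>Rank is the dimension of the column set, and inserting \<open>b\<close> raises it by one
  exactly when \<open>b\<close> lies outside the span.\<close>

lemma rank_augmented_eq_iff:
  "rank (augmented A b) = rank A \<longleftrightarrow> b \<in> range ((*v) A)"
  by (simp add: column_rank_def columns_augmented dim_insert
      range_matrix_vector_mult_eq_span_columns)

text \<open>The null space is the orthogonal complement of the row space, whose dimension is the
  rank.\<close>

lemma dim_nullspace: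
  fixes A :: "real^'n^'m"
  shows "dim {x. A *v x = 0} + rank A = CARD('n)"
proof -
  have "{x. A *v x = 0} = {x \<in> UNIV. \<forall>y \<in> rows A. orthogonal y x}"
    by (auto simp: rows_def row_def vec_eq_iff[where y=0] matrix_mult_dot orthogonal_def)
  moreover have "dim {x \<in> UNIV. \<forall>y \<in> span (rows A). orthogonal y x} + dim (span (rows A)) =
      dim (UNIV :: (real^'n) set)"
    by (rule dim_subspace_orthogonal_to_vectors) auto
  moreover have "{x \<in> UNIV. \<forall>y \<in> rows A. orthogonal y x} =
      {x \<in> UNIV. \<forall>y \<in> span (rows A). orthogonal y x}"
    by (meson orthogonal_to_span orthogonal_commute span_base)
  ultimately show ?thesis
    by (simp add: row_rank_def)
qed

lemma range_matrix_of_columns: "range ((*v) (matrix_of_columns \<eta>)) = span (range \<eta>)"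
proof -
  have "columns (matrix_of_columns \<eta>) = range \<eta>"
    by (auto simp: columns_def column_def matrix_of_columns_def)
  then show ?thesis
    by (simp add: range_matrix_vector_mult_eq_span_columns)
qed

lemma nullspace_eq_span:
  fixes A :: "real^'s^'m" and \<eta> :: "'k::finite \<Rightarrow> real^'s"
  assumes "independent_family \<eta>" and "CARD('k) = CARD('s) - rank A" and "\<And>j. A *v \<eta> j = 0"
  shows "{x. A *v x = 0} = span (range \<eta>)"
proof
  \<comment> \<open>Injectivity matters here: a repeated vector would make the range too small to
    span.\<close>
  have "card (range \<eta>) = CARD('k)"
    using assms(1) by (simp add: independent_family_def card_image)
  \<comment> \<open>The additive form of \<open>dim_nullspace\<close> gives \<open>rank A\<close>
    \<le> \<open>CARD('s)\<close>, so the subtraction on naturals is exact. An independent subset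
    with as many elements as the dimension spans.\<close>
  with assms dim_nullspace[of A] show "{x. A *v x = 0} \<subseteq> span (range \<eta>)"
    by (intro card_ge_dim_independent) (auto simp: independent_family_def)
  show "span (range \<eta>) \<subseteq> {x. A *v x = 0}"
    using assms(3) by (intro span_minimal) (auto simp: subspace_def matrix_vector_right_distrib
        matrix_vector_mult_scaleR)
qed

lemma ex_is_solution_iff:
  "(\<exists>X. is_solution A \<beta> X) \<longleftrightarrow> (\<forall>p. rank (augmented A (\<beta> p)) = rank A)"
proof -
  have "(\<exists>X. is_solution A \<beta> X) \<longleftrightarrow> (\<forall>p. \<exists>x. A *v x = \<beta> p)"
    unfolding is_solution_def by (rule choice_iff[symmetric])
  also have "\<dots> \<longleftrightarrow> (\<forall>p. \<beta> p \<in> range ((*v) A))"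
    by (metis rangeI imageE)
  finally show ?thesis
    by (simp add: rank_augmented_eq_iff)
qed

text \<open>At each point the solution set is a translate of the null space, which is the column
  space of \<open>matrix_of_columns \<eta>\<close>.\<close>

lemma solutions_eq:
  fixes A :: "real^'s^'m" and \<eta> :: "'k::finite \<Rightarrow> real^'s"
  assumes X\<^sub>0: "is_solution A \<beta> X\<^sub>0" and \<eta>: "{x. A *v x = 0} = span (range \<eta>)"
  shows "{X. is_solution A \<beta> X} = {X. \<exists>Z. X = (\<lambda>p. X\<^sub>0 p + matrix_of_columns \<eta> *v Z p)}"
proof -
  have "is_solution A \<beta> X \<longleftrightarrow> (\<exists>Z. X = (\<lambda>p. X\<^sub>0 p + matrix_of_columns \<eta> *v Z p))" for X
  proof -
    have "is_solution A \<beta> X \<longleftrightarrow> (\<forall>p. A *v (X p - X\<^sub>0 p) = 0)"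
      using X\<^sub>0 by (simp add: is_solution_def matrix_vector_mult_diff_distrib)
    also have "\<dots> \<longleftrightarrow> (\<forall>p. X p - X\<^sub>0 p \<in> range ((*v) (matrix_of_columns \<eta>)))"
      using \<eta> by (simp add: range_matrix_of_columns set_eq_iff)
    also have "\<dots> \<longleftrightarrow> (\<forall>p. \<exists>z. X p = X\<^sub>0 p + matrix_of_columns \<eta> *v z)"
      by (simp add: image_iff diff_eq_eq add.commute)
    \<comment> \<open>The axiom of choice turns pointwise coefficient vectors into one function
      \<open>Z\<close>.\<close>
    also have "\<dots> \<longleftrightarrow> (\<exists>Z. X = (\<lambda>p. X\<^sub>0 p + matrix_of_columns \<eta> *v Z p))"
      by (simp add: choice_iff fun_eq_iff)
    finally show ?thesis .
  qed
  then show ?thesis by simp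
qed

theorem theorem2p1:
  fixes A :: "real^'s^'m" and \<beta> :: "real^4 \<Rightarrow> real^'m"
  shows "((\<exists>X. is_solution A \<beta> X) \<longleftrightarrow> (\<forall>p. rank (augmented A (\<beta> p)) = rank A)) \<and>
    (\<forall>(r :: nat) (X\<^sub>0 :: real^4 \<Rightarrow> real^'s) (\<eta> :: 'k::finite \<Rightarrow> real^'s).
      (\<exists>X. is_solution A \<beta> X) \<and> rank A = r \<and> r < CARD('s) \<and> is_solution A \<beta> X\<^sub>0 \<and>
      CARD('k) = CARD('s) - r \<and> independent_family \<eta> \<and>
      (\<forall>j. is_solution A (\<lambda>p. 0) (\<lambda>p. \<eta> j))
      \<longrightarrow> {X. is_solution A \<beta> X} =
          {X. \<exists>Z\<^sub>1 :: real^4 \<Rightarrow> real^'k. X = (\<lambda>p. X\<^sub>0 p + matrix_of_columns \<eta> *v Z\<^sub>1 p)})"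
proof (intro conjI allI impI)
  show "(\<exists>X. is_solution A \<beta> X) \<longleftrightarrow> (\<forall>p. rank (augmented A (\<beta> p)) = rank A)"
    by (rule ex_is_solution_iff)
next
  fix r X\<^sub>0 and \<eta> :: "'k \<Rightarrow> real^'s"
  assume "(\<exists>X. is_solution A \<beta> X) \<and> rank A = r \<and> r < CARD('s) \<and> is_solution A \<beta> X\<^sub>0 \<and>
      CARD('k) = CARD('s) - r \<and> independent_family \<eta> \<and>
      (\<forall>j. is_solution A (\<lambda>p. 0) (\<lambda>p. \<eta> j))"
  then show "{X. is_solution A \<beta> X} =
      {X. \<exists>Z\<^sub>1 :: real^4 \<Rightarrow> real^'k. X = (\<lambda>p. X\<^sub>0 p + matrix_of_columns \<eta> *v Z\<^sub>1 p)}"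
    by (intro solutions_eq nullspace_eq_span) (auto simp: is_solution_def)
qed

end
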